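(* For every positive integer $n$ with $k=\omega(n)\ge 74$, $$\tau(n)<\left(1+\frac{\log n}{k\log k}\right)^k.$$
   Context: $\tau(n)$ denotes the number of positive divisors of $n$ and $\omega(n)$ the number of distinct prime factors of $n$. *)

theory Defs
  imports Complex_Main "HOL-Computational_Algebra.Primes"
begin

definition divisor_count :: "nat \<Rightarrow> nat" where
  "divisor_count n = card {d. d dvd n}"

definition primes_omega :: "nat \<Rightarrow> nat" where
  "primes_omega n = card (prime_factors n)"

end

theory Submission
  imports Defs "HOL-Number_Theory.Totient" "HOL-Analysis.Harmonic_Numbers"
begin

text \<open>
  The proof is an induction on the number \<open>k\<close> of prime factors, starting at the sharp case \<open>k = 74\<close>
  and carrying along \<open>k ln k \<le> ln n\<close>.

  For the step write \<open>n = p\<^sup>a m\<close> with \<open>p\<close> the largest prime factor. Counting residues coprime to 30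
  and 210 gives \<open>p \<ge> (64/15) (k + 1)\<close>, and this linear bound already suffices: weighted AM-GM with
  weights \<open>k\<close> and \<open>1\<close> splits the new bound into the old one times \<open>a + 1\<close>.

  For \<open>k = 74\<close> the \<open>i\<close>-th prime factor may be replaced by the \<open>i\<close>-th prime. Writing
  \<open>R = (\<Sum>i. a\<^sub>i ln p\<^sub>i / ln 74)\<close>, one has to show \<open>(\<Sum>i. ln (a\<^sub>i + 1)) < 74 ln (1 + R / 74)\<close> for integers
  \<open>a\<^sub>i \<ge> 1\<close>. For large \<open>R\<close> this is AM-GM. On a bounded range of \<open>R\<close> the left hand side lies below five
  affine functions of \<open>R\<close> (Lagrange multipliers for the integer optimisation problem), each of which
  lies below the concave right hand side on an interval because it does so at the two endpoints. For
  real \<open>a\<^sub>i\<close> the inequality would fail, so the integrality of the exponents is essential here.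
\<close>

section \<open>Divisors and prime factors\<close>

text \<open>Every divisor of the product is some \<open>p ^ i\<close> with \<open>i \<le> a\<close>
  times a divisor of \<open>m\<close>; counting these pairs bounds the number of divisors from
  above.\<close>

lemma divisor_count_primepow_mult_le:
  assumes "prime p" "m > 0"
  shows "divisor_count (p ^ a * m) \<le> (a + 1) * divisor_count m"
proof -
  have "{d. d dvd p ^ a * m} \<subseteq> (\<lambda>(i, e). p ^ i * e) ` ({..a} \<times> {e. e dvd m})"
  proof
    fix d assume "d \<in> {d. d dvd p ^ a * m}"
    then obtain b e where "d = b * e" "b dvd p ^ a" "e dvd m"
      using division_decomp[of d "p ^ a" m] by auto
    then show "d \<in> (\<lambda>(i, e). p ^ i * e) ` ({..a} \<times> {e. e dvd m})"
      using assms(1) by (auto simp: divides_primepow_nat)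
  qed
  moreover have fin: "finite ({..a} \<times> {e. e dvd m})"
    using assms(2) by simp
  ultimately have "divisor_count (p ^ a * m) \<le> card ({..a} \<times> {e. e dvd m})"
    unfolding divisor_count_def by (meson surj_card_le)
  then show ?thesis
    by (simp add: divisor_count_def card_cartesian_product)
qed

lemma divisor_count_prod_primepow_le:
  assumes "finite S" "\<forall>p\<in>S. prime p"
  shows "divisor_count (\<Prod>p\<in>S. p ^ f p) \<le> (\<Prod>p\<in>S. f p + 1)"
  using assms
proof (induction S rule: finite_induct)
  case empty
  then show ?case by (simp add: divisor_count_def)
next
  case (insert p S)
  have "(\<Prod>p\<in>S. p ^ f p) > 0"
    using insert by (auto intro!: prod_pos simp: prime_gt_0_nat)
  then have "divisor_count (p ^ f p * (\<Prod>p\<in>S. p ^ f p))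
      \<le> (f p + 1) * divisor_count (\<Prod>p\<in>S. p ^ f p)"
    using insert.prems by (intro divisor_count_primepow_mult_le) auto
  also have "\<dots> \<le> (f p + 1) * (\<Prod>p\<in>S. f p + 1)"
    using insert by (intro mult_left_mono insert.IH) auto
  finally show ?case using insert by simp
qed

lemma divisor_count_le_prod:
  assumes "n > 0"
  shows "divisor_count n \<le> (\<Prod>p\<in>prime_factors n. multiplicity p n + 1)"
proof -
  have "divisor_count (\<Prod>p\<in>prime_factors n. p ^ multiplicity p n)
      \<le> (\<Prod>p\<in>prime_factors n. multiplicity p n + 1)"
    by (intro divisor_count_prod_primepow_le) auto
  then show ?thesis
    using prime_factorization_nat[OF assms] by simp
qed

lemma split_off_prime_factor:
  fixes n p :: nat
  assumes "n > 0" "p \<in> prime_factors n"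
  obtains a m where "n = p ^ a * m" "a \<ge> 1" "m > 0" "prime_factors m = prime_factors n - {p}"
proof -
  have p: "prime p" "p dvd n" using assms(2) by auto
  obtain m where m: "n = p ^ multiplicity p n * m" "\<not> p dvd m"
    using multiplicity_decompose'[of n p] assms p by (metis bot_nat_0.not_eq_extremum not_prime_unit)
  have "m > 0" using m(2) by (cases m) auto
  have a: "multiplicity p n \<ge> 1"
    using assms(1) p by (simp add: multiplicity_geI Suc_leI prime_multiplicity_gt_zero_iff)
  have "prime_factors n = insert p (prime_factors m)"
  proof -
    have "prime_factors n = prime_factors (p ^ multiplicity p n) \<union> prime_factors m"
      using m(1) \<open>m > 0\<close> p by (metis assms(1) mult_is_0 not_gr0 prime_factors_product)
    also have "prime_factors (p ^ multiplicity p n) = {p}"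
      using p a by (simp add: prime_factors_power prime_prime_factors)
    finally show ?thesis by simp
  qed
  moreover have "p \<notin> prime_factors m" using m(2) by auto
  ultimately show thesis using that[OF m(1) a \<open>m > 0\<close>] by auto
qed

section \<open>Lower bounds for the i-th prime factor\<close>

text \<open>Reduction modulo \<open>m\<close> is injective on \<open>m\<close> consecutive integers
  and keeps coprimality to \<open>m\<close>, so the window embeds into the totatives.\<close>

lemma card_coprime_window_le:
  fixes m x :: nat
  assumes "m > 1"
  shows "card {r \<in> {x..<x + m}. coprime r m} \<le> totient m"
proof -
  have inj: "inj_on (\<lambda>r. r mod m) {x..<x + m}"
  proof (rule linorder_inj_onI')
    fix r s assume *: "r \<in> {x..<x + m}" "s \<in> {x..<x + m}" "r < s"
    show "r mod m \<noteq> s mod m"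
    proof
      assume "r mod m = s mod m"
      then have "m dvd s - r" using *(3) by (metis mod_eq_dvd_iff_nat less_imp_le)
      then show False using * by (auto dest: dvd_imp_le)
    qed
  qed
  have "(\<lambda>r. r mod m) ` {r \<in> {x..<x + m}. coprime r m} \<subseteq> totatives m"
  proof
    fix t assume "t \<in> (\<lambda>r. r mod m) ` {r \<in> {x..<x + m}. coprime r m}"
    then obtain r where r: "t = r mod m" "coprime r m" by auto
    then have "coprime t m" using assms by simp
    \<comment> \<open>Totatives are positive by definition; residue 0 cannot occur because 0 is not
      coprime to \<open>m > 1\<close>.\<close>
    then show "t \<in> totatives m"
      using assms r by (cases "t = 0") (auto simp: totatives_def)
  qed
  then have "card ((\<lambda>r. r mod m) ` {r \<in> {x..<x + m}. coprime r m}) \<le> totient m"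
    unfolding totient_def by (intro card_mono) auto
  moreover have "card ((\<lambda>r. r mod m) ` {r \<in> {x..<x + m}. coprime r m})
      = card {r \<in> {x..<x + m}. coprime r m}"
    by (rule card_image) (rule inj_on_subset[OF inj], auto)
  ultimately show ?thesis by simp
qed

text \<open>Pigeonhole: otherwise \<open>totient m + 1\<close> distinct entries coprime to
  \<open>m\<close> would lie in a window of length \<open>m\<close>.\<close>

lemma sorted_coprime_gap:
  fixes qs :: "nat list"
  assumes sorted: "sorted_wrt (<) qs" and "m > 1" and len: "i + totient m < length qs"
    and cop: "\<And>j. i \<le> j \<Longrightarrow> j < length qs \<Longrightarrow> coprime (qs ! j) m"
  shows "qs ! i + m \<le> qs ! (i + totient m)"
proof (rule ccontr)
  assume *: "\<not> ?thesis"
  have mono: "qs ! j < qs ! l" if "j < l" "l < length qs" for j l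
    using sorted_wrt_nth_less[OF sorted] that by simp
  have inj: "inj_on ((!) qs) {i..i + totient m}"
    using len by (intro linorder_inj_onI') (force dest: mono)
  have "(!) qs ` {i..i + totient m} \<subseteq> {r \<in> {qs ! i..<qs ! i + m}. coprime r m}"
  proof
    fix r assume "r \<in> (!) qs ` {i..i + totient m}"
    then obtain j where j: "r = qs ! j" "i \<le> j" "j \<le> i + totient m" by auto
    have "qs ! i \<le> qs ! j" using mono[of i j] j len by (cases "i = j") auto
    moreover have "qs ! j \<le> qs ! (i + totient m)"
      using mono[of j "i + totient m"] j len by (cases "j = i + totient m") auto
    ultimately show "r \<in> {r \<in> {qs ! i..<qs ! i + m}. coprime r m}"
      using * j len cop by auto
  qed
  then have "card ((!) qs ` {i..i + totient m}) \<le> card {r \<in> {qs ! i..<qs ! i + m}. coprime r m}"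
    by (intro card_mono) auto
  then show False
    using card_coprime_window_le[OF \<open>m > 1\<close>, of "qs ! i"] by (simp add: card_image[OF inj])
qed

definition first_primes :: "nat list" where
  "first_primes = [2, 3, 5, 7, 11, 13, 17, 19, 23, 29, 31, 37, 41, 43, 47, 53, 59, 61, 67, 71,
    73, 79, 83, 89, 97, 101, 103, 107, 109, 113, 127, 131, 137, 139, 149, 151, 157, 163, 167, 173,
    179, 181, 191, 193, 197, 199, 211, 223, 227, 229, 233, 239, 241, 251, 257, 263, 269, 271, 277,
    281, 283, 293, 307, 311, 313, 317, 331, 337, 347, 349, 353, 359, 367, 373]"

lemma length_first_primes: "length first_primes = 74"
  by (simp add: first_primes_def)

lemma sorted_first_primes: "sorted_wrt (<) first_primes"
  by (simp add: first_primes_def)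

lemma prime_in_first_primes:
  assumes "prime p" "p \<le> 373"
  shows "p \<in> set first_primes"
proof -
  \<comment> \<open>Trial division by primes up to 19 suffices, since the square of 23 exceeds 373.
    The check runs over the integers so that it evaluates on binary numerals.\<close>
  have "list_all (\<lambda>m. List.member (map int first_primes) m \<or>
      list_ex (\<lambda>d. d dvd m \<and> d \<noteq> m) [2, 3, 5, 7, 11, 13, 17, 19]) [2..373]"
    unfolding first_primes_def list.map of_nat_numeral by code_simp
  moreover have "int p \<in> set [2..373]"
    unfolding set_upto using assms prime_ge_2_nat[of p] by simp
  ultimately have "List.member (map int first_primes) (int p) \<or>
      list_ex (\<lambda>d. d dvd int p \<and> d \<noteq> int p) [2, 3, 5, 7, 11, 13, 17, 19]"
    unfolding list_all_iff by (rule bspec)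
  then consider "int p \<in> set (map int first_primes)"
    | d where "d \<in> set [2, 3, 5, 7, 11, 13, 17, 19]" "d dvd int p" "d \<noteq> int p"
    unfolding list_ex_iff List.member_iff by blast
  then show ?thesis
  proof cases
    case 2
    have "d > 1" using 2(1) by auto
    then show ?thesis using prime_int_iff[of "int p"] assms(1) 2 by (auto dest: spec[of _ d])
  qed auto
qed

text \<open>In the step, a smaller \<open>qs ! Suc i\<close> would be a prime strictly between two
  consecutive entries of \<open>first_primes\<close>, and that list contains every prime up to
  373.\<close>

lemma nth_first_primes_le:
  assumes sorted: "sorted_wrt (<) qs" and prime: "\<And>q. q \<in> set qs \<Longrightarrow> prime q"
    and "i < length qs" "i < 74"
  shows "first_primes ! i \<le> qs ! i"
  using assms(3,4)
proof (induction i)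
  case 0
  then have "prime (qs ! 0)" using prime by simp
  then show ?case by (simp add: first_primes_def prime_ge_2_nat)
next
  case (Suc i)
  show ?case
  proof (rule ccontr)
    assume less: "\<not> first_primes ! Suc i \<le> qs ! Suc i"
    have mono: "first_primes ! j \<le> first_primes ! l" if "j \<le> l" "l < 74" for j l
      using sorted_wrt_nth_less[OF sorted_first_primes, of j l] that length_first_primes
      by (cases "j = l") auto
    have "first_primes ! Suc i \<le> first_primes ! 73"
      using Suc.prems by (intro mono) auto
    also have "\<dots> = 373" by (simp add: first_primes_def)
    finally have "qs ! Suc i \<in> set first_primes"
      using less prime Suc.prems by (intro prime_in_first_primes) auto
    then obtain j where j: "j < 74" "qs ! Suc i = first_primes ! j"
      using length_first_primes by (metis in_set_conv_nth)
    have "first_primes ! i \<le> qs ! i" using Suc by simp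
    also have "\<dots> < qs ! Suc i"
      using sorted_wrt_nth_less[OF sorted, of i "Suc i"] Suc.prems by simp
    finally have "\<not> j \<le> i" using mono[of j i] j Suc.prems by auto
    moreover have "\<not> Suc i \<le> j" using mono[of "Suc i" j] j less by auto
    ultimately show False by simp
  qed
qed

lemma totient_30: "totient 30 = 8" and totient_210: "totient 210 = 48"
proof -
  have step: "totient (p * m) = (p - 1) * totient m" if "prime p" "\<not> p dvd m" for p m
    using that by (simp add: totient_mult_coprime prime_imp_coprime totient_prime)
  show *: "totient 30 = 8"
    using step[of 5 6] step[of 3 2] by (simp add: totient_prime)
  show "totient 210 = 48"
    using step[of 7 30] * by simp
qed

text \<open>Beyond index 74 the entries exceed 210, hence are coprime to 30 and 210: 8 indices gain
  at least 30, and 48 indices at least 210. Indices start at 0, so \<open>i + 1\<close> counts the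
  primes up to \<open>qs ! i\<close>.\<close>

lemma sorted_primes_ge:
  assumes sorted: "sorted_wrt (<) qs" and prime: "\<And>q. q \<in> set qs \<Longrightarrow> prime q"
    and "74 \<le> i" "i < length qs"
  shows "64 * (i + 1) \<le> 15 * qs ! i"
proof -
  have big: "qs ! j \<ge> 374" if "74 \<le> j" "j < length qs" for j
  proof -
    have "373 \<le> qs ! 73"
      using nth_first_primes_le[OF sorted prime, of 73] that by (simp add: first_primes_def)
    also have "qs ! 73 < qs ! j"
      using sorted_wrt_nth_less[OF sorted, of 73 j] that by simp
    finally show ?thesis by simp
  qed
  have cop: "coprime (qs ! j) m" if "74 \<le> j" "j < length qs" "m \<in> {30, 210}" for j m
    using big[OF that(1,2)] that prime[of "qs ! j"]
    by (intro prime_imp_coprime) (auto dest: dvd_imp_le)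
  have gap30: "qs ! j + 30 \<le> qs ! (j + 8)" if "74 \<le> j" "j + 8 < length qs" for j
    using sorted_coprime_gap[OF sorted, of 30 j] cop that by (simp add: totient_30)
  have gap210: "qs ! j + 210 \<le> qs ! (j + 48)" if "74 \<le> j" "j + 48 < length qs" for j
    using sorted_coprime_gap[OF sorted, of 210 j] cop that by (simp add: totient_210)
  have gaps30: "qs ! j + 30 * l \<le> qs ! (j + 8 * l)" if "74 \<le> j" "j + 8 * l < length qs" for j l
    using that(2)
  proof (induction l)
    case (Suc l)
    then show ?case using gap30[of "j + 8 * l"] that(1) by (simp add: algebra_simps)
  qed simp
  have gaps210: "qs ! j + 210 * l \<le> qs ! (j + 48 * l)" if "74 \<le> j" "j + 48 * l < length qs" for j l
    using that(2)
  proof (induction l)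
    case (Suc l)
    then show ?case using gap210[of "j + 48 * l"] that(1) by (simp add: algebra_simps)
  qed simp
  define r where "r = (i - 74) mod 48"
  define a b c where "a = (i - 74) div 48" and "b = r div 8" and "c = r mod 8"
  have "i - 74 = 48 * a + r" "r = 8 * b + c" "r < 48" "c < 8"
    by (simp_all add: r_def a_def b_def c_def)
  \<comment> \<open>Use \<open>a\<close> windows of length 210, \<open>b\<close> of length 30, and
    no gain for the remaining \<open>c\<close> indices. The slack is
    \<open>810 - 62 * b - 64 * c + 78 * a\<close>, which is at least 52.\<close>
  then have i: "i = 74 + c + 8 * b + 48 * a" and "b \<le> 5" "c \<le> 7"
    using assms(3) by linarith+
  have "374 + 30 * b + 210 * a \<le> qs ! i"
    using big[of "74 + c"] gaps30[of "74 + c" b] gaps210[of "74 + c + 8 * b" a] assms(4) i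
    by simp
  then show ?thesis using i \<open>b \<le> 5\<close> \<open>c \<le> 7\<close> by simp
qed

section \<open>The induction step\<close>

text \<open>The left side is the first term of the series
  \<open>ln x = 2 * artanh ((x - 1) / (x + 1))\<close> at \<open>x = 1 + v\<close>.\<close>

lemma ln_add_one_ge_pade:
  assumes "v \<ge> 0"
  shows "2 * v / (2 + v) \<le> ln (1 + v :: real)"
  using ln_approx_bounds[of "1 + v" 1] assms by (cases "v = 0") (auto simp: add.commute)

text \<open>AM-GM for \<open>k\<close> copies of \<open>C\<close> and one \<open>D\<close>, obtained
  from Bernoulli's inequality for the ratio \<open>B / C\<close>.\<close>

lemma weighted_am_gm:
  fixes B C D :: real
  assumes "B \<ge> 0" "C > 0" "real k * C + D \<le> real (k + 1) * B"
  shows "C ^ k * D \<le> B ^ (k + 1)"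
proof -
  have "D / C \<le> 1 + real (k + 1) * (B / C - 1)"
    using assms by (simp add: field_simps)
  also have "\<dots> \<le> (1 + (B / C - 1)) ^ (k + 1)"
    using assms by (intro Bernoulli_inequality) simp
  also have "\<dots> = B ^ (k + 1) / C ^ (k + 1)"
    by (simp add: power_divide)
  finally show ?thesis
    using assms by (simp add: field_simps)
qed

text \<open>After taking logarithms, the loss of the \<open>k\<close> factors is at most
  \<open>w / 0.996\<close> and the gain at least \<open>2 * v / (2 + v)\<close>. With
  \<open>w = 49 / 58 * v\<close> and \<open>v \<le> 0.34\<close> the gain wins.\<close>

lemma shrink_factor_ge:
  fixes l :: real
  assumes "k \<ge> 74" "l \<ge> 43 / 10"
  shows "1 \<le> (1 + 29 / 20 / l) * (1 - 49 / 40 / l / real k) ^ k"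
proof -
  define v w where "v = 29 / 20 / l" and "w = 49 / 40 / l"
  have v: "0 < v" "v \<le> 34 / 100" and w: "w = 49 / 58 * v"
    using assms unfolding v_def w_def by (auto simp: field_simps)
  have k: "real k \<ge> 74" using assms by simp
  define z where "z = w / real k"
  have z: "0 < z" "z \<le> 4 / 1000" "real k * z = w"
    using v w k by (auto simp: z_def field_simps)
  have "ln (1 / (1 - z)) \<le> 1 / (1 - z) - 1"
    using z by (intro ln_le_minus_one) simp
  then have "- ln (1 - z) \<le> z / (1 - z)"
    using z by (simp add: ln_div field_simps)
  also have "\<dots> \<le> z / (996 / 1000)"
    using z by (intro divide_left_mono) auto
  finally have "real k * - ln (1 - z) \<le> real k * (z / (996 / 1000))"
    by (rule mult_left_mono) simp
  also have "\<dots> = w / (996 / 1000)" using z by simp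
  also have "\<dots> \<le> 2 * v / (2 + v)"
  proof -
    have "v * v \<le> v * (34 / 100)" using v by (intro mult_left_mono) auto
    then show ?thesis using v by (simp add: w field_simps)
  qed
  also have "\<dots> \<le> ln (1 + v)" using v by (intro ln_add_one_ge_pade) simp
  finally have "0 \<le> ln ((1 + v) * (1 - z) ^ k)"
    using v z by (simp add: ln_mult ln_realpow)
  then have "1 \<le> (1 + v) * (1 - z) ^ k"
    using v z by simp
  then show ?thesis by (simp add: v_def w_def z_def)
qed

lemma ln_Suc_diff_le:
  assumes "k > 0"
  shows "real k * (ln (real k + 1) - ln (real k)) \<le> 1"
proof -
  have "ln (real k + 1) - ln (real k) = ln (1 + 1 / real k)"
    using assms ln_div[of "real k + 1" "real k"] by (simp add: add_divide_distrib)
  also have "\<dots> \<le> 1 / real k" by (intro ln_add_one_self_le_self) simp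
  finally show ?thesis using assms by (simp add: field_simps)
qed

text \<open>Here \<open>L\<close> stands for the logarithm of the cofactor and \<open>x\<close> for
  that of the new prime of exponent \<open>a\<close>. AM-GM is applied to \<open>A * c\<close> and
  \<open>(a + 1) * y\<close>, where \<open>y * c ^ k \<ge> 1\<close> removes the auxiliary
  factors.\<close>

lemma divisor_bound_step:
  fixes L x :: real
  assumes k: "k \<ge> 74" and l: "ln (real k + 1) \<ge> 43 / 10" and L: "real k * ln (real k) \<le> L"
    and "a \<ge> 1" and x: "x \<ge> ln (real k + 1) + 29 / 20"
  shows "(real a + 1) * (1 + L / (real k * ln (real k))) ^ k
    \<le> (1 + (L + real a * x) / (real (k + 1) * ln (real (k + 1)))) ^ (k + 1)"
proof -
  define l l' where "l = ln (real k)" and "l' = ln (real k + 1)"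
  define A where "A = 1 + L / (real k * l)"
  define B where "B = 1 + (L + real a * x) / (real (k + 1) * l')"
  \<comment> \<open>The constant 49/40 makes \<open>main\<close> reduce to
    \<open>29/20 - 1 \<le> (49/40 - 1) * A\<close>, which is exactly
    \<open>A \<ge> 2\<close>.\<close>
  define y c where "y = 1 + 29 / 20 / l'" and "c = 1 - 49 / 40 / l' / real k"
  have pos: "l > 0" "l' > 0" "real k \<ge> 74" using k l by (auto simp: l_def l'_def)
  have A: "A \<ge> 2" using L pos by (simp add: A_def l_def field_simps)
  have L_eq: "L = real k * l * (A - 1)" using pos by (simp add: A_def)
  have Lpos: "L > 0" using L_eq A pos by simp
  have c: "c > 0"
  proof -
    have "49 / 40 / l' < 1" using pos(2) l by (simp add: l'_def[symmetric] pos_divide_less_eq)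
    then have "49 / 40 / l' < real k" using pos by linarith
    then have "49 / 40 / l' / real k < 1" using pos by (simp only: divide_less_eq_1) simp
    then show ?thesis by (simp add: c_def)
  qed
  have diff: "real k * l' - real k * l \<le> 1"
    using ln_Suc_diff_le[of k] k by (simp add: l_def l'_def algebra_simps)
  have main: "real k * (A * c) + (real a + 1) * y \<le> real (k + 1) * B"
  proof -
    have "(real k * l' - real k * l) * (A - 1) \<le> 1 * (A - 1)"
      using diff A by (intro mult_right_mono) auto
    then have 1: "real k * l' * (A - 1) - (A - 1) \<le> L"
      by (simp add: L_eq algebra_simps)
    have ly: "l' * y = l' + 29 / 20" using pos by (simp add: y_def distrib_left)
    have 2: "real a * (l' * y) \<le> real a * x"
      using x ly by (intro mult_left_mono) (auto simp: l'_def)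
    have "l' * (real k * (A * c)) = l' * real k * A - 49 / 40 * A"
      using pos by (simp add: c_def right_diff_distrib)
    moreover have "l' * (real (k + 1) * B) = l' * real (k + 1) + L + real a * x"
    proof -
      have "M * (1 + t / M) = M + t" if "M > 0" for M t :: real
        using that by (simp add: distrib_left)
      from this[of "real (k + 1) * l'" "L + real a * x"] show ?thesis
        using pos by (simp add: B_def mult_ac)
    qed
    moreover have "l' * ((real a + 1) * y) = real a * (l' * y) + l' * y"
      by (simp add: algebra_simps)
    moreover have "l' * real (k + 1) = l' * real k + l'" by (simp add: algebra_simps)
    moreover have "real k * l' * (A - 1) = l' * real k * A - l' * real k" by (simp add: algebra_simps)
    ultimately have "l' * (real k * (A * c) + (real a + 1) * y) \<le> l' * (real (k + 1) * B)"
      unfolding distrib_left[of l'] using 1 2 A ly by linarith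
    then show ?thesis using pos by simp
  qed
  have x0: "x > 0" using x l by simp
  have "B \<ge> 0" using Lpos x0 pos by (simp add: B_def)
  have "(real a + 1) * A ^ k * 1 \<le> (real a + 1) * A ^ k * (y * c ^ k)"
    using shrink_factor_ge[of k l'] k l A
    by (intro mult_left_mono) (auto simp: y_def c_def l'_def)
  also have "\<dots> = (A * c) ^ k * ((real a + 1) * y)" by (simp add: power_mult_distrib)
  also have "\<dots> \<le> B ^ (k + 1)"
    using main c A \<open>B \<ge> 0\<close> by (intro weighted_am_gm) auto
  finally show ?thesis by (simp add: A_def B_def l_def l'_def add.commute)
qed

section \<open>Numerical bounds for logarithms\<close>

text \<open>Ratios near 1 need few series terms; 3, 5, 7, 11 and 13 each differ from a product of
  smaller primes by one of these ratios or its inverse.\<close>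

lemma ln_small_ratio_bounds:
  shows
"ln (2::real) \<in> {6931471 / 10 ^ 7..6931473 / 10 ^ 7}"
  and "ln (3/2::real) \<in> {4054651 / 10 ^ 7..4054652 / 10 ^ 7}"
  and "ln (5/4::real) \<in> {2231435 / 10 ^ 7..2231436 / 10 ^ 7}"
  and "ln (8/7::real) \<in> {1335313 / 10 ^ 7..1335314 / 10 ^ 7}"
  and "ln (11/10::real) \<in> {953101 / 10 ^ 7..953102 / 10 ^ 7}"
  and "ln (13/12::real) \<in> {800427 / 10 ^ 7..800428 / 10 ^ 7}"
  subgoal using ln_approx_bounds[of "2" 7] by (simp add: eval_nat_numeral)
  subgoal using ln_approx_bounds[of "3/2" 5] by (simp add: eval_nat_numeral)
  subgoal using ln_approx_bounds[of "5/4" 4] by (simp add: eval_nat_numeral)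
  subgoal using ln_approx_bounds[of "8/7" 3] by (simp add: eval_nat_numeral)
  subgoal using ln_approx_bounds[of "11/10" 3] by (simp add: eval_nat_numeral)
  subgoal using ln_approx_bounds[of "13/12" 3] by (simp add: eval_nat_numeral)
  done

text \<open>Bounds for \<open>10\<^sup>7 ln m\<close>, indexed by \<open>m \<le> 17\<close>; entry 0 is a dummy.\<close>

definition ln_lo :: "int list" where
  "ln_lo = [0, 0, 6931471, 10986122, 13862942, 16094377, 17917593, 19459099, 20794413, 21972244, 23025848,
    23978949, 24849064, 25649491, 26390570, 27080499, 27725884, 28331944]"

definition ln_hi :: "int list" where
  "ln_hi = [0, 0, 6931473, 10986125, 13862946, 16094382, 17917598, 19459106, 20794419, 21972250, 23025855,
    23978957, 24849071, 25649499, 26390579, 27080507, 27725892, 28332510]"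

lemma ln_prime_bounds:
  shows ln_2: "ln 2 \<in> {real_of_int (ln_lo ! 2) / 10 ^ 7..real_of_int (ln_hi ! 2) / 10 ^ 7}"
    and ln_3: "ln 3 \<in> {real_of_int (ln_lo ! 3) / 10 ^ 7..real_of_int (ln_hi ! 3) / 10 ^ 7}"
    and ln_5: "ln 5 \<in> {real_of_int (ln_lo ! 5) / 10 ^ 7..real_of_int (ln_hi ! 5) / 10 ^ 7}"
    and ln_7: "ln 7 \<in> {real_of_int (ln_lo ! 7) / 10 ^ 7..real_of_int (ln_hi ! 7) / 10 ^ 7}"
    and ln_11: "ln 11 \<in> {real_of_int (ln_lo ! 11) / 10 ^ 7..real_of_int (ln_hi ! 11) / 10 ^ 7}"
    and ln_13: "ln 13 \<in> {real_of_int (ln_lo ! 13) / 10 ^ 7..real_of_int (ln_hi ! 13) / 10 ^ 7}"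
proof -
  have eqs: "ln (3::real) = ln 2 + ln (3 / 2)" "ln (5::real) = 2 * ln 2 + ln (5 / 4)"
    "ln (7::real) = 3 * ln 2 - ln (8 / 7)" "ln (11::real) = ln 2 + ln 5 + ln (11 / 10)"
    "ln (13::real) = 2 * ln 2 + ln 3 + ln (13 / 12)"
    using ln_realpow[of 2 2] ln_realpow[of 2 3] ln_mult[of 2 5] ln_mult[of 4 3] by (simp_all add: ln_div)
  show "ln 2 \<in> {real_of_int (ln_lo ! 2) / 10 ^ 7..real_of_int (ln_hi ! 2) / 10 ^ 7}"
    using ln_small_ratio_bounds eqs by (simp add: ln_lo_def ln_hi_def)
  show "ln 3 \<in> {real_of_int (ln_lo ! 3) / 10 ^ 7..real_of_int (ln_hi ! 3) / 10 ^ 7}"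
    using ln_small_ratio_bounds eqs by (simp add: ln_lo_def ln_hi_def)
  show "ln 5 \<in> {real_of_int (ln_lo ! 5) / 10 ^ 7..real_of_int (ln_hi ! 5) / 10 ^ 7}"
    using ln_small_ratio_bounds eqs by (simp add: ln_lo_def ln_hi_def)
  show "ln 7 \<in> {real_of_int (ln_lo ! 7) / 10 ^ 7..real_of_int (ln_hi ! 7) / 10 ^ 7}"
    using ln_small_ratio_bounds eqs by (simp add: ln_lo_def ln_hi_def)
  show "ln 11 \<in> {real_of_int (ln_lo ! 11) / 10 ^ 7..real_of_int (ln_hi ! 11) / 10 ^ 7}"
    using ln_small_ratio_bounds eqs by (simp add: ln_lo_def ln_hi_def)
  show "ln 13 \<in> {real_of_int (ln_lo ! 13) / 10 ^ 7..real_of_int (ln_hi ! 13) / 10 ^ 7}"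
    using ln_small_ratio_bounds eqs by (simp add: ln_lo_def ln_hi_def)
qed

lemma ln_bounds:
  assumes "1 \<le> m" "m \<le> 17"
  shows "real_of_int (ln_lo ! m) \<le> 10 ^ 7 * ln (real m)"
    "10 ^ 7 * ln (real m) \<le> real_of_int (ln_hi ! m)"
proof -
  have eqs: "ln (4::real) = ln 2 + ln 2" "ln (6::real) = ln 2 + ln 3" "ln (8::real) = ln 2 + ln 4"
    "ln (9::real) = ln 3 + ln 3" "ln (10::real) = ln 2 + ln 5" "ln (12::real) = ln 2 + ln 6"
    "ln (14::real) = ln 2 + ln 7" "ln (15::real) = ln 3 + ln 5" "ln (16::real) = ln 2 + ln 8"
    using ln_mult[of 2 2] ln_mult[of 2 3] ln_mult[of 2 4] ln_mult[of 3 3] ln_mult[of 2 5]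
      ln_mult[of 2 6] ln_mult[of 2 7] ln_mult[of 3 5] ln_mult[of 2 8] by simp_all
  \<comment> \<open>The value 17 occurs as \<open>b + 2\<close> for the largest exponent
    \<open>b = 15\<close>. One series term is used, which explains the looser entry of
    \<open>ln_hi\<close>.\<close>
  have "ln (17::real) = ln 16 + ln (17 / 16)" by (simp add: ln_div)
  then have 17: "ln (17::real) \<in> {ln 16 + 2 / 33..ln 16 + 33 / 544}"
    using ln_approx_bounds[of "17 / 16" 1] by (simp add: power2_eq_square power3_eq_cube)
  have "m = 1 \<or> m = 2 \<or> m = 3 \<or> m = 4 \<or> m = 5 \<or> m = 6 \<or> m = 7 \<or> m = 8 \<or> m = 9 \<or>
      m = 10 \<or> m = 11 \<or> m = 12 \<or> m = 13 \<or> m = 14 \<or> m = 15 \<or> m = 16 \<or> m = 17"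
    using assms by (auto simp: numeral_eq_Suc le_Suc_eq)
  then have "real_of_int (ln_lo ! m) \<le> 10 ^ 7 * ln (real m) \<and>
      10 ^ 7 * ln (real m) \<le> real_of_int (ln_hi ! m)"
    using ln_prime_bounds eqs 17 by (elim disjE) (simp_all add: ln_lo_def ln_hi_def)
  then show "real_of_int (ln_lo ! m) \<le> 10 ^ 7 * ln (real m)"
    "10 ^ 7 * ln (real m) \<le> real_of_int (ln_hi ! m)"
    by auto
qed

text \<open>
  The table collects pairs of \<open>q\<close> and a lower bound for \<open>10\<^sup>7 ln q\<close>. Each list of factors of some \<open>m\<close>
  adds an entry for \<open>m + 1\<close> by \<open>ln (m + 1) \<ge> ln m + 2 / (2 m + 1)\<close>; for a prime \<open>p\<close> the list is the
  prime factorization of \<open>p - 1\<close>.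
\<close>

fun extend_ln_lower_bounds :: "(int \<times> int) list \<Rightarrow> int list list \<Rightarrow> (int \<times> int) list" where
  "extend_ln_lower_bounds t [] = t"
| "extend_ln_lower_bounds t (fs # fss) =
    (let m = prod_list fs; c = sum_list (map (\<lambda>f. case map_of t f of None \<Rightarrow> 0 | Some c \<Rightarrow> c) fs)
     in extend_ln_lower_bounds (t @ [(m + 1, c + 2 * 10 ^ 7 div (2 * m + 1))]) fss)"

lemma extend_ln_lower_bounds_sound:
  assumes "\<forall>(q, c)\<in>set t. real_of_int c \<le> 10 ^ 7 * ln (real_of_int q)"
    and "list_all (list_all (\<lambda>f. f \<ge> 1)) fss"
  shows "\<forall>(q, c)\<in>set (extend_ln_lower_bounds t fss). real_of_int c \<le> 10 ^ 7 * ln (real_of_int q)"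
  using assms
proof (induction t fss rule: extend_ln_lower_bounds.induct)
  case (2 t fs fss)
  \<comment> \<open>A factor missing from the table contributes 0, still a valid lower bound because
    \<open>f \<ge> 1\<close>.\<close>
  define lb where "lb f = (case map_of t f of None \<Rightarrow> 0 | Some c \<Rightarrow> c)" for f
  define m where "m = prod_list fs"
  have lb: "real_of_int (lb f) \<le> 10 ^ 7 * ln (real_of_int f)" if "f \<ge> 1" for f
    using 2(2) that by (auto simp: lb_def split: option.split dest!: map_of_SomeD)
  have "list_all (\<lambda>f. f \<ge> 1) gs \<Longrightarrow> prod_list gs \<ge> 1 \<and>
      real_of_int (sum_list (map lb gs)) \<le> 10 ^ 7 * ln (real_of_int (prod_list gs))" for gs
  proof (induction gs)
    case (Cons g gs)
    then have "1 * 1 \<le> g * prod_list gs" by (intro mult_mono) auto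
    then show ?case using Cons lb[of g] by (simp add: ln_mult distrib_left)
  qed simp
  from this[of fs] have m: "m \<ge> 1" "real_of_int (sum_list (map lb fs)) \<le> 10 ^ 7 * ln (real_of_int m)"
    using 2(3) by (auto simp: m_def)
  have "real_of_int (2 * 10 ^ 7 div (2 * m + 1)) \<le> real_of_int (2 * 10 ^ 7) / real_of_int (2 * m + 1)"
    by (rule real_of_int_div4)
  also have "\<dots> = 10 ^ 7 * (2 * (1 / real_of_int m) / (2 + 1 / real_of_int m))"
    using m(1) by (simp add: field_simps)
  also have "\<dots> \<le> 10 ^ 7 * ln (1 + 1 / real_of_int m)"
    using m(1) by (intro mult_left_mono ln_add_one_ge_pade) auto
  also have "1 + 1 / real_of_int m = real_of_int (m + 1) / real_of_int m"
    using m(1) by (simp add: field_simps)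
  also have "ln \<dots> = ln (real_of_int (m + 1)) - ln (real_of_int m)"
    using m(1) by (simp add: ln_div)
  finally have "real_of_int (sum_list (map lb fs) + 2 * 10 ^ 7 div (2 * m + 1))
      \<le> 10 ^ 7 * ln (real_of_int (m + 1))"
    using m(2) by simp
  then have "\<forall>(q, c)\<in>set (t @ [(m + 1, sum_list (map lb fs) + 2 * 10 ^ 7 div (2 * m + 1))]).
      real_of_int c \<le> 10 ^ 7 * ln (real_of_int q)"
    using 2(2) by auto
  then show ?case
    using 2(1)[OF refl refl] 2(3) by (simp add: m_def lb_def[abs_def] Let_def)
qed simp

text \<open>As 75 is 3 times 25, \<open>ln 75\<close> is known; a lower bound for
  \<open>ln (75 / 74)\<close> then bounds \<open>ln 74\<close>, the denominator of the log ratios,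
  from above.\<close>

lemma ln_74_le: "10 ^ 7 * ln 74 \<le> (43040661 :: real)"
proof -
  have "ln (75::real) = ln 3 + 2 * ln 5"
    using ln_mult[of 3 25] ln_realpow[of 5 2] by simp
  moreover have "ln (75::real) = ln 74 + ln (1 + 1 / 74)" by (simp add: ln_div)
  moreover have "ln (1 + 1 / 74 :: real) \<ge> 2 / 149" using ln_add_one_ge_pade[of "1 / 74"] by simp
  ultimately show ?thesis using ln_3 ln_5 by (simp add: ln_lo_def ln_hi_def)
qed

text \<open>Lower bounds for \<open>10\<^sup>5 ln p / ln 74\<close> for the first 74 primes \<open>p\<close>.\<close>

definition log_ratios :: "int list" where
  "log_ratios = [16104, 25524, 37393, 45210, 55712, 59593, 65825, 68410, 72849, 78235, 79784, 83895, 86280,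
    87387, 89453, 92245, 94736, 95511, 97691, 99038, 99683, 101519, 102666, 104288, 106288,
    107226, 107682, 108567, 108998, 109835, 112549, 113269, 114309, 114646, 116260, 116570,
    117476, 118347, 118910, 119730, 120522, 120781, 122030, 122272, 122749, 122983, 124344,
    125629, 126042, 126245, 126648, 127238, 127432, 128377, 128926, 129462, 129986, 130158,
    130667, 131000, 131165, 131972, 133056, 133357, 133506, 133801, 134805, 135222, 135902,
    136035, 136300, 136692, 137204, 137580]"

lemma length_log_ratios: "length log_ratios = 74"
  by (simp add: log_ratios_def)

lemma log_ratios_pos:
  assumes "i < 74"
  shows "log_ratios ! i > 0"
proof -
  have "list_all (\<lambda>N. N > 0) log_ratios" by (simp add: log_ratios_def)
  then show ?thesis using assms by (simp add: list_all_length length_log_ratios)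
qed

lemma log_ratios_le:
  assumes "i < 74"
  shows "real_of_int (log_ratios ! i) / 10 ^ 5 * ln 74 \<le> ln (real (first_primes ! i))"
proof -
  define t :: "(int \<times> int) list" where
    "t = [(2, 6931471), (3, 10986122), (5, 16094377), (7, 19459099), (11, 23978949), (13, 25649491)]"
  define fss :: "int list list" where
    "fss = [[2, 2, 2, 2], [2, 3, 3], [2, 11], [2, 2, 7], [2, 3, 5], [2, 2, 3, 3], [2, 2, 2, 5], [2, 3, 7],
    [2, 23], [2, 2, 13], [2, 29], [2, 2, 3, 5], [2, 3, 11], [2, 5, 7], [2, 2, 2, 3, 3], [2, 3,
    13], [2, 41], [2, 2, 2, 11], [2, 2, 2, 2, 2, 3], [2, 2, 5, 5], [2, 3, 17], [2, 53], [2, 2,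
    3, 3, 3], [2, 2, 2, 2, 7], [2, 3, 3, 7], [2, 5, 13], [2, 2, 2, 17], [2, 3, 23], [2, 2, 37],
    [2, 3, 5, 5], [2, 2, 3, 13], [2, 3, 3, 3, 3], [2, 83], [2, 2, 43], [2, 89], [2, 2, 3, 3, 5],
    [2, 5, 19], [2, 2, 2, 2, 2, 2, 3], [2, 2, 7, 7], [2, 3, 3, 11], [2, 3, 5, 7], [2, 3, 37],
    [2, 113], [2, 2, 3, 19], [2, 2, 2, 29], [2, 7, 17], [2, 2, 2, 2, 3, 5], [2, 5, 5, 5], [2, 2,
    2, 2, 2, 2, 2, 2], [2, 131], [2, 2, 67], [2, 3, 3, 3, 5], [2, 2, 3, 23], [2, 2, 2, 5, 7],
    [2, 3, 47], [2, 2, 73], [2, 3, 3, 17], [2, 5, 31], [2, 2, 2, 3, 13], [2, 2, 79], [2, 3, 5,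
    11], [2, 2, 2, 2, 3, 7], [2, 173], [2, 2, 3, 29], [2, 2, 2, 2, 2, 11], [2, 179], [2, 3, 61],
    [2, 2, 3, 31]]"
  have "\<forall>(q, c)\<in>set t. real_of_int c \<le> 10 ^ 7 * ln (real_of_int q)"
    using ln_prime_bounds by (simp add: t_def ln_lo_def)
  moreover have "list_all (list_all (\<lambda>f. f \<ge> 1)) fss" by (simp add: fss_def)
  ultimately have sound: "\<forall>(q, c)\<in>set (extend_ln_lower_bounds t fss).
      real_of_int c \<le> 10 ^ 7 * ln (real_of_int q)"
    by (rule extend_ln_lower_bounds_sound)
  \<comment> \<open>The evaluation checks that the keys of the table are exactly the first 74
    primes, and compares each ratio after clearing denominators with the upper bound for
    \<open>ln 74\<close>.\<close>
  have all2: "list_all2 (\<lambda>p (N, q, c). q = p \<and> N * 43040661 \<le> 10 ^ 5 * c) (map int first_primes)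
      (zip log_ratios (extend_ln_lower_bounds t fss))"
    unfolding first_primes_def list.map of_nat_numeral log_ratios_def t_def fss_def by code_simp
  have len: "i < length (extend_ln_lower_bounds t fss)"
    using list_all2_lengthD[OF all2] assms by (simp add: length_first_primes length_log_ratios)
  obtain q c where nth: "extend_ln_lower_bounds t fss ! i = (q, c)" by (rule prod.exhaust)
  then have qc: "(q, c) \<in> set (extend_ln_lower_bounds t fss)" "q = int (first_primes ! i)"
      "log_ratios ! i * 43040661 \<le> 10 ^ 5 * c"
    using list_all2_nthD[OF all2, of i] nth_mem[OF len] len assms
    by (simp_all add: length_first_primes length_log_ratios)
  have "real_of_int (log_ratios ! i) * (10 ^ 7 * ln 74) \<le> real_of_int (log_ratios ! i) * 43040661"
    using ln_74_le assms by (intro mult_left_mono) (auto simp: log_ratios_pos less_imp_le)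
  also have "\<dots> \<le> 10 ^ 5 * real_of_int c"
    using of_int_le_iff[where 'a = real, THEN iffD2, OF qc(3)] by simp
  also have "\<dots> \<le> 10 ^ 5 * (10 ^ 7 * ln (real (first_primes ! i)))"
    using sound qc(1,2) by (intro mult_left_mono) auto
  finally show ?thesis by simp
qed

section \<open>Seventy-four prime factors\<close>

text \<open>The increments of \<open>ln (a + 1)\<close> decrease, so a slope between the increments
  after and before \<open>b\<close> gives a line above all integer points. At \<open>b = 1\<close>
  there is no smaller admissible exponent, so only the increment after it matters.\<close>

lemma ln_Suc_le_line:
  fixes c :: real
  assumes "1 \<le> a" "1 \<le> b" and up: "ln (real b + 2) - ln (real b + 1) \<le> c"
    and down: "b = 1 \<or> c \<le> ln (real b + 1) - ln (real b)"
  shows "ln (real a + 1) \<le> ln (real b + 1) + c * (real a - real b)"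
proof -
  have decr: "ln (real j + 2) - ln (real j + 1) \<le> ln (real i + 2) - ln (real i + 1)" if "i \<le> j" for i j :: nat
  proof -
    have "ln (real i + 1) + ln (real j + 2) = ln ((real i + 1) * (real j + 2))"
      by (simp add: ln_mult)
    also have "\<dots> \<le> ln ((real i + 2) * (real j + 1))"
      using that by (intro ln_le_cancel_iff[THEN iffD2] mult_pos_pos) (auto simp: algebra_simps)
    also have "\<dots> = ln (real i + 2) + ln (real j + 1)" by (simp add: ln_mult)
    finally show ?thesis by simp
  qed
  show ?thesis
  proof (cases "b \<le> a")
    case True
    then show ?thesis
    proof (induction a rule: dec_induct)
      case (step j)
      then show ?case using decr[of b j] up by (simp add: algebra_simps)
    qed simp
  next
    case False
    then have "a \<le> b" by simp
    then show ?thesis using assms(1)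
    proof (induction a rule: inc_induct)
      case (step j)
      have "ln (real (b - 1) + 2) - ln (real (b - 1) + 1) \<le> ln (real j + 2) - ln (real j + 1)"
        using step by (intro decr) simp
      moreover have "real (b - 1) + 2 = real b + 1" "real (b - 1) + 1 = real b"
        using assms(2) by (simp_all add: of_nat_diff)
      ultimately have "ln (real b + 1) - ln (real b) \<le> ln (real j + 2) - ln (real j + 1)"
        by (simp only:)
      then have "c \<le> ln (real j + 2) - ln (real j + 1)"
        using down step by auto
      then show ?case using step by (simp add: algebra_simps)
    qed simp
  qed
qed

text \<open>By concavity \<open>r * ln A\<close> lies on or above its chord, and the chord lies
  strictly above the affine function.\<close>

lemma affine_less_ln:
  fixes A0 A1 A :: real
  assumes "0 < A0" "A0 \<le> A" "A \<le> A1"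
    and "p + q * A0 < r * ln A0" "p + q * A1 < r * ln A1" "0 \<le> r"
  shows "p + q * A < r * ln A"
proof (cases "A0 = A1")
  case True
  then show ?thesis using assms by simp
next
  case False
  define t where "t = (A - A0) / (A1 - A0)"
  have t: "0 \<le> t" "t \<le> 1" using assms False by (auto simp: t_def field_simps)
  have "t * (A1 - A0) = A - A0" using False by (simp add: t_def)
  then have A: "A = (1 - t) * A0 + t * A1" by (simp add: algebra_simps)
  have "(1 - t) * ln A0 + t * ln A1 \<le> ln A"
    using concave_onD[OF ln_concave, of t A0 A1] t assms by (simp add: A)
  then have "r * ((1 - t) * ln A0 + t * ln A1) \<le> r * ln A"
    using assms by (intro mult_left_mono)
  moreover have "(1 - t) * (p + q * A0) + t * (p + q * A1) < (1 - t) * (r * ln A0) + t * (r * ln A1)"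
  proof (cases "t = 0")
    case False
    then show ?thesis
      using t assms by (intro add_le_less_mono mult_left_mono mult_strict_left_mono) auto
  qed (use assms in auto)
  ultimately show ?thesis by (simp add: A algebra_simps)
qed

text \<open>
  A line has slope \<open>l / 1000\<close> and touches at the exponents \<open>bs\<close>: the check says that \<open>b\<close> maximises
  \<open>ln (b + 1) - l / 1000 * b * y\<close> over the positive integers, where \<open>y\<close> is the log ratio.
\<close>

definition line_check :: "int \<Rightarrow> nat list \<Rightarrow> bool" where
  "line_check l bs \<longleftrightarrow> list_all2 (\<lambda>N b. 1 \<le> b \<and> b \<le> 15 \<and>
     10 * (ln_hi ! (b + 2) - ln_lo ! (b + 1)) \<le> l * N \<and>
     (b = 1 \<or> l * N \<le> 10 * (ln_lo ! (b + 1) - ln_hi ! b))) log_ratios bs"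

text \<open>This is \<open>R\<close> with the log ratios rounded down, hence a lower bound for
  \<open>ln n / ln 74\<close> when \<open>a i\<close> is the exponent of the i-th smallest of the 74
  prime factors.\<close>

definition weighted_sum :: "(nat \<Rightarrow> nat) \<Rightarrow> real" where
  "weighted_sum a = (\<Sum>i<74. real (a i) * (real_of_int (log_ratios ! i) / 10 ^ 5))"

text \<open>The i-th line has slope proportional to the i-th log ratio with the common multiplier
  \<open>l / 1000\<close>, so the linear terms add up to a function of \<open>weighted_sum a\<close>
  alone.\<close>

lemma sum_ln_le_line:
  assumes check: "line_check l bs" and a: "\<And>i. i < 74 \<Longrightarrow> 1 \<le> a i"
  shows "(\<Sum>i<74. ln (real (a i) + 1))
    \<le> real_of_int (sum_list (map (\<lambda>b. ln_hi ! (b + 1)) bs)) / 10 ^ 7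
    + real_of_int l / 10 ^ 3 *
      (weighted_sum a - real_of_int (sum_list (map2 (\<lambda>N b. N * int b) log_ratios bs)) / 10 ^ 5)"
proof -
  have len: "length bs = 74"
    using check unfolding line_check_def by (auto dest!: list_all2_lengthD simp: length_log_ratios)
  have hi: "real_of_int (sum_list (map (\<lambda>b. ln_hi ! (b + 1)) bs))
      = (\<Sum>i<74. real_of_int (ln_hi ! (bs ! i + 1)))"
    by (simp add: sum_list_sum_nth len atLeast0LessThan)
  have R: "real_of_int (sum_list (map2 (\<lambda>N b. N * int b) log_ratios bs))
      = (\<Sum>i<74. real_of_int (log_ratios ! i) * real (bs ! i))"
    by (simp add: sum_list_sum_nth len length_log_ratios atLeast0LessThan)
  have "(\<Sum>i<74. ln (real (a i) + 1)) \<le> (\<Sum>i<74. real_of_int (ln_hi ! (bs ! i + 1)) / 10 ^ 7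
    + real_of_int l / 10 ^ 3 * (real (a i) * (real_of_int (log_ratios ! i) / 10 ^ 5)
      - real_of_int (log_ratios ! i) * real (bs ! i) / 10 ^ 5))"
  proof (rule sum_mono)
    fix i :: nat assume "i \<in> {..<74}"
    then have i: "i < 74" by simp
    define N b where "N = log_ratios ! i" and "b = bs ! i"
    have c: "1 \<le> b" "b \<le> 15" "10 * (ln_hi ! (b + 2) - ln_lo ! (b + 1)) \<le> l * N"
      "b = 1 \<or> l * N \<le> 10 * (ln_lo ! (b + 1) - ln_hi ! b)"
      using check i unfolding line_check_def
      by (auto dest!: list_all2_nthD[of _ _ _ i] simp: length_log_ratios N_def b_def)
    have b2: "10 ^ 7 * ln (real b + 2) \<le> real_of_int (ln_hi ! (b + 2))"
      using ln_bounds(2)[of "b + 2"] c by (simp add: add.commute)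
    have b1: "real_of_int (ln_lo ! (b + 1)) \<le> 10 ^ 7 * ln (real b + 1)"
        "10 ^ 7 * ln (real b + 1) \<le> real_of_int (ln_hi ! (b + 1))"
      using ln_bounds[of "b + 1"] c by (simp_all add: add.commute)
    have b0: "10 ^ 7 * ln (real b) \<le> real_of_int (ln_hi ! b)"
      using ln_bounds(2)[of b] c by simp
    \<comment> \<open>Common scale \<open>10 ^ 8\<close>: \<open>l\<close> carries
      \<open>10 ^ 3\<close> and \<open>N\<close> carries \<open>10 ^ 5\<close>, while the logarithms
      carry \<open>10 ^ 7\<close>; hence the factor 10.\<close>
    have up: "10 * (real_of_int (ln_hi ! (b + 2)) - real_of_int (ln_lo ! (b + 1))) \<le> real_of_int (l * N)"
      using of_int_le_iff[where 'a = real, THEN iffD2, OF c(3)] by simp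
    have down: "b = 1 \<or> real_of_int (l * N) \<le> 10 * (real_of_int (ln_lo ! (b + 1)) - real_of_int (ln_hi ! b))"
      using c(4) by (metis of_int_diff of_int_le_iff of_int_mult of_int_numeral)
    have "ln (real (a i) + 1) \<le> ln (real b + 1) + real_of_int (l * N) / 10 ^ 8 * (real (a i) - real b)"
      using a[OF i] c(1) b0 b1 b2 up down by (intro ln_Suc_le_line) auto
    also have "\<dots> \<le> real_of_int (ln_hi ! (b + 1)) / 10 ^ 7
        + real_of_int (l * N) / 10 ^ 8 * (real (a i) - real b)"
      using b1 by simp
    also have "\<dots> = real_of_int (ln_hi ! (b + 1)) / 10 ^ 7
      + real_of_int l / 10 ^ 3 * (real (a i) * (real_of_int N / 10 ^ 5) - real_of_int N * real b / 10 ^ 5)"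
      by (simp add: field_simps)
    finally show "ln (real (a i) + 1) \<le> real_of_int (ln_hi ! (bs ! i + 1)) / 10 ^ 7
      + real_of_int l / 10 ^ 3 * (real (a i) * (real_of_int (log_ratios ! i) / 10 ^ 5)
        - real_of_int (log_ratios ! i) * real (bs ! i) / 10 ^ 5)"
      by (simp add: N_def b_def)
  qed
  also have "\<dots> = real_of_int (sum_list (map (\<lambda>b. ln_hi ! (b + 1)) bs)) / 10 ^ 7
    + real_of_int l / 10 ^ 3 *
      (weighted_sum a - real_of_int (sum_list (map2 (\<lambda>N b. N * int b) log_ratios bs)) / 10 ^ 5)"
    unfolding hi R weighted_sum_def sum.distrib
      sum_subtractf sum_distrib_left[symmetric] sum_divide_distrib[symmetric] ..
  finally show ?thesis .
qed

text \<open>With \<open>X\<close> and \<open>Z\<close> given as numerals, only two numerical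
  inequalities remain, at the ends of an interval for
  \<open>1 + weighted_sum a / 74\<close>.\<close>

lemma sum_ln_less_on_interval:
  assumes check: "line_check l bs" and a: "\<And>i. i < 74 \<Longrightarrow> 1 \<le> a i"
    and X: "sum_list (map (\<lambda>b. ln_hi ! (b + 1)) bs) = X"
    and Z: "sum_list (map2 (\<lambda>N b. N * int b) log_ratios bs) = Z"
    and A: "0 < A0" "A0 \<le> 1 + weighted_sum a / 74" "1 + weighted_sum a / 74 \<le> A1"
    and A0: "real_of_int X / 10 ^ 7 + real_of_int l / 10 ^ 3 * (74 * (A0 - 1) - real_of_int Z / 10 ^ 5)
      < 74 * ln A0"
    and A1: "real_of_int X / 10 ^ 7 + real_of_int l / 10 ^ 3 * (74 * (A1 - 1) - real_of_int Z / 10 ^ 5)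
      < 74 * ln A1"
  shows "(\<Sum>i<74. ln (real (a i) + 1)) < 74 * ln (1 + weighted_sum a / 74)"
proof -
  define q where "q = 74 * (real_of_int l / 10 ^ 3)"
  define p where "p = real_of_int X / 10 ^ 7 - real_of_int l / 10 ^ 3 * (74 + real_of_int Z / 10 ^ 5)"
  have pq: "p + q * t =
      real_of_int X / 10 ^ 7 + real_of_int l / 10 ^ 3 * (74 * (t - 1) - real_of_int Z / 10 ^ 5)" for t
    unfolding p_def q_def by (simp add: algebra_simps)
  have "p + q * A0 < 74 * ln A0" "p + q * A1 < 74 * ln A1"
    using A0 A1 unfolding pq .
  from affine_less_ln[OF A this]
  have "p + q * (1 + weighted_sum a / 74) < 74 * ln (1 + weighted_sum a / 74)" by simp
  moreover have "p + q * (1 + weighted_sum a / 74)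
      = real_of_int X / 10 ^ 7 + real_of_int l / 10 ^ 3 * (weighted_sum a - real_of_int Z / 10 ^ 5)"
    unfolding pq by simp
  moreover have "(\<Sum>i<74. ln (real (a i) + 1)) \<le> real_of_int X / 10 ^ 7
      + real_of_int l / 10 ^ 3 * (weighted_sum a - real_of_int Z / 10 ^ 5)"
    using sum_ln_le_line[OF check a] unfolding X Z .
  ultimately show ?thesis by linarith
qed

text \<open>
  The slopes and the breakpoints of \<open>ln_breakpoints\<close> were found by a numerical search with 13-smooth
  breakpoints; the smallest gap to \<open>74 ln (1 + R / 74)\<close> at an endpoint is about \<open>0.0025\<close>.
\<close>

lemma line_456:
  defines "bs \<equiv> [13, 8, 5, 4, 3, 3, 2, 2, 2, 2, 2, 2, 2, 2] @ replicate 60 1"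
  shows "line_check 456 bs" "sum_list (map (\<lambda>b. ln_hi ! (b + 1)) bs) = 613878081"
    "sum_list (map2 (\<lambda>N b. N * int b) log_ratios bs) = 9570174"
  unfolding bs_def line_check_def log_ratios_def ln_hi_def ln_lo_def by code_simp+

lemma line_431:
  defines "bs \<equiv> [13, 8, 5, 4, 3, 3, 3] @ replicate 9 2 @ replicate 58 1"
  shows "line_check 431 bs" "sum_list (map (\<lambda>b. ln_hi ! (b + 1)) bs) = 624864206"
    "sum_list (map2 (\<lambda>N b. N * int b) log_ratios bs) = 9817697"
  unfolding bs_def line_check_def log_ratios_def ln_hi_def ln_lo_def by code_simp+

lemma line_426:
  defines "bs \<equiv> [14, 8, 5, 4, 3, 3, 3] @ replicate 10 2 @ replicate 57 1"
  shows "line_check 426 bs" "sum_list (map (\<lambda>b. ln_hi ! (b + 1)) bs) = 629608786"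
    "sum_list (map2 (\<lambda>N b. N * int b) log_ratios bs) = 9928537"
  unfolding bs_def line_check_def log_ratios_def ln_hi_def ln_lo_def by code_simp+

lemma line_418:
  defines "bs \<equiv> [14, 8, 5, 4, 3, 3, 3, 3] @ replicate 10 2 @ replicate 56 1"
  shows "line_check 418 bs" "sum_list (map (\<lambda>b. ln_hi ! (b + 1)) bs) = 636540259"
    "sum_list (map2 (\<lambda>N b. N * int b) log_ratios bs) = 10092458"
  unfolding bs_def line_check_def log_ratios_def ln_hi_def ln_lo_def by code_simp+

lemma line_387:
  defines "bs \<equiv> [15, 9, 6, 5, 4, 3, 3, 3, 3] @ replicate 15 2 @ replicate 50 1"
  shows "line_check 387 bs" "sum_list (map (\<lambda>b. ln_hi ! (b + 1)) bs) = 671040142"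
    "sum_list (map2 (\<lambda>N b. N * int b) log_ratios bs) = 10950135"
  unfolding bs_def line_check_def log_ratios_def ln_hi_def ln_lo_def by code_simp+

lemma ln_breakpoints:
  shows "ln (25 / 12) \<ge> (7339683 / 10 ^ 7 :: real)"
    and "ln (30 / 13) \<ge> (8362471 / 10 ^ 7 :: real)"
    and "ln (7 / 3) \<ge> (8472974 / 10 ^ 7 :: real)"
    and "ln (33 / 14) \<ge> (8574492 / 10 ^ 7 :: real)"
    and "ln (63 / 26) \<ge> (8850371 / 10 ^ 7 :: real)"
    and "ln (96 / 35) \<ge> (10089989 / 10 ^ 7 :: real)"
proof -
  have eqs: "ln (12::real) = ln 2 + ln 2 + ln 3" "ln (14::real) = ln 2 + ln 7"
    "ln (25::real) = ln 5 + ln 5" "ln (26::real) = ln 2 + ln 13"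
    "ln (30::real) = ln 2 + ln 3 + ln 5" "ln (33::real) = ln 3 + ln 11"
    "ln (35::real) = ln 5 + ln 7" "ln (63::real) = ln 3 + ln 3 + ln 7"
    "ln (96::real) = ln 2 + ln 2 + ln 2 + ln 2 + ln 2 + ln 3"
    using ln_mult[of 2 3] ln_mult[of 2 6] ln_mult[of 2 7] ln_mult[of 3 5] ln_mult[of 3 7]
      ln_mult[of 2 12] ln_mult[of 5 5] ln_mult[of 2 13] ln_mult[of 2 15] ln_mult[of 3 11]
      ln_mult[of 5 7] ln_mult[of 2 24] ln_mult[of 3 21] ln_mult[of 2 48] by simp_all
  show "ln (25 / 12) \<ge> (7339683 / 10 ^ 7 :: real)"
    using ln_prime_bounds eqs by (simp add: ln_div ln_lo_def ln_hi_def)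
  show "ln (30 / 13) \<ge> (8362471 / 10 ^ 7 :: real)"
    using ln_prime_bounds eqs by (simp add: ln_div ln_lo_def ln_hi_def)
  show "ln (7 / 3) \<ge> (8472974 / 10 ^ 7 :: real)"
    using ln_prime_bounds eqs by (simp add: ln_div ln_lo_def ln_hi_def)
  show "ln (33 / 14) \<ge> (8574492 / 10 ^ 7 :: real)"
    using ln_prime_bounds eqs by (simp add: ln_div ln_lo_def ln_hi_def)
  show "ln (63 / 26) \<ge> (8850371 / 10 ^ 7 :: real)"
    using ln_prime_bounds eqs by (simp add: ln_div ln_lo_def ln_hi_def)
  show "ln (96 / 35) \<ge> (10089989 / 10 ^ 7 :: real)"
    using ln_prime_bounds eqs by (simp add: ln_div ln_lo_def ln_hi_def)
qed

section \<open>AM-GM for large exponents\<close>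

text \<open>Summing \<open>ln t \<le> t - 1\<close> over \<open>t = z i / c\<close>, with
  \<open>c\<close> the mean, makes the right side vanish.\<close>

lemma sum_ln_le_ln_mean:
  fixes z :: "'a \<Rightarrow> real"
  assumes "finite I" "I \<noteq> {}" "\<And>i. i \<in> I \<Longrightarrow> 0 < z i"
  shows "(\<Sum>i\<in>I. ln (z i)) \<le> real (card I) * ln ((\<Sum>i\<in>I. z i) / real (card I))"
proof -
  define c where "c = (\<Sum>i\<in>I. z i) / real (card I)"
  have c: "c > 0" using assms by (simp add: c_def sum_pos card_gt_0_iff)
  have "(\<Sum>i\<in>I. ln (z i) - ln c) \<le> (\<Sum>i\<in>I. z i / c - 1)"
  proof (rule sum_mono)
    fix i assume "i \<in> I"
    then have "0 < z i" by (rule assms(3))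
    then show "ln (z i) - ln c \<le> z i / c - 1"
      using ln_le_minus_one[of "z i / c"] c by (simp add: ln_div)
  qed
  also have "\<dots> = (\<Sum>i\<in>I. z i) / c - real (card I)"
    by (simp add: sum_subtractf sum_divide_distrib)
  also have "\<dots> = 0"
    using c assms by (auto simp: c_def)
  finally show ?thesis by (simp add: sum_subtractf c_def)
qed

lemma sum_log_ratios: "(\<Sum>i<74. real_of_int (log_ratios ! i)) = 8059781"
proof -
  have "sum_list log_ratios = 8059781" by (simp add: log_ratios_def)
  then have "real_of_int (\<Sum>i<74. log_ratios ! i) = 8059781"
    by (simp add: sum_list_sum_nth length_log_ratios atLeast0LessThan)
  then show ?thesis by simp
qed

text \<open>Rounding down after each factor keeps the numbers small.\<close>

lemma foldr_mult_div_le: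
  assumes "list_all (\<lambda>N. 0 < N) Ns" "0 < d"
  shows "real_of_int (foldr (\<lambda>N c. c * N div d) Ns c)
    \<le> real_of_int c * prod_list (map (\<lambda>N. real_of_int N / real_of_int d) Ns)"
  using assms
proof (induction Ns)
  case (Cons N Ns)
  define r where "r = foldr (\<lambda>N c. c * N div d) Ns c"
  have "real_of_int (r * N div d) \<le> real_of_int (r * N) / real_of_int d"
    by (rule real_of_int_div4)
  also have "\<dots> = real_of_int r * (real_of_int N / real_of_int d)" by simp
  also have "\<dots> \<le> real_of_int c * prod_list (map (\<lambda>N. real_of_int N / real_of_int d) Ns)
      * (real_of_int N / real_of_int d)"
    unfolding r_def using Cons by (intro mult_right_mono) auto
  finally show ?case by (simp add: r_def mult_ac)
qed simp

text \<open>The geometric mean of the log ratios is at least 1.033, in logarithmic form.\<close>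

lemma sum_ln_log_ratios_ge: "74 * ln (1033 / 1000) \<le> (\<Sum>i<74. ln (real_of_int (log_ratios ! i) / 10 ^ 5))"
proof -
  \<comment> \<open>The initial value \<open>10 ^ 6\<close> keeps six decimals of the product
    through the roundings.\<close>
  have "foldr (\<lambda>N c. c * N div 10 ^ 5) log_ratios (10 ^ 6) = 11291293"
    unfolding log_ratios_def by code_simp
  moreover have "list_all (\<lambda>N. 0 < N) log_ratios"
    by (simp add: list_all_length log_ratios_pos length_log_ratios)
  ultimately have prod_ge: "11291293 / 10 ^ 6 \<le> prod_list (map (\<lambda>N. real_of_int N / 10 ^ 5) log_ratios)"
    using foldr_mult_div_le[of log_ratios "10 ^ 5" "10 ^ 6"] by simp
  have "(1033 / 1000 :: real) ^ 74 \<le> 11291293 / 10 ^ 6"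
    by (simp add: power_divide)
  also note prod_ge
  also have "prod_list (map (\<lambda>N. real_of_int N / 10 ^ 5) log_ratios)
      = (\<Prod>i<74. real_of_int (log_ratios ! i) / 10 ^ 5)"
    by (simp add: prod.list_conv_set_nth length_log_ratios atLeast0LessThan)
  finally have le: "(1033 / 1000) ^ 74 \<le> (\<Prod>i<74. real_of_int (log_ratios ! i) / 10 ^ 5)" .
  have "74 * ln (1033 / 1000) = ln ((1033 / 1000 :: real) ^ 74)"
    by (subst ln_realpow) auto
  also have "\<dots> \<le> ln (\<Prod>i<74. real_of_int (log_ratios ! i) / 10 ^ 5)"
    by (rule ln_le_cancel_iff[THEN iffD2, OF _ _ le]) (auto intro!: prod_pos simp: log_ratios_pos)
  also have "\<dots> = (\<Sum>i<74. ln (real_of_int (log_ratios ! i) / 10 ^ 5))"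
    by (rule ln_prod) (auto dest!: log_ratios_pos)
  finally show ?thesis .
qed

text \<open>AM-GM is applied to \<open>(a i + 1) * y i\<close>, whose sum depends only on
  \<open>weighted_sum a\<close>; the geometric mean of the \<open>y i\<close> is then divided
  out.\<close>

lemma sum_ln_less_tail:
  assumes a: "\<And>i. i < 74 \<Longrightarrow> 1 \<le> a i" and A: "96 / 35 \<le> 1 + weighted_sum a / 74"
  shows "(\<Sum>i<74. ln (real (a i) + 1)) < 74 * ln (1 + weighted_sum a / 74)"
proof -
  define y where "y i = real_of_int (log_ratios ! i) / 10 ^ 5" for i
  have y: "y i > 0" if "i < 74" for i using log_ratios_pos[OF that] by (simp add: y_def)
  have "(\<Sum>i<74. y i) = 8059781 / 10 ^ 5"
    using sum_log_ratios by (simp add: y_def flip: sum_divide_distrib)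
  moreover have "weighted_sum a = (\<Sum>i<74. real (a i) * y i)"
    by (simp only: weighted_sum_def y_def)
  ultimately have sum: "(\<Sum>i<74. (real (a i) + 1) * y i) = weighted_sum a + 8059781 / 10 ^ 5"
    by (simp add: distrib_right sum.distrib)
  have "(\<Sum>i<74. ln (real (a i) + 1)) + 74 * ln (1033 / 1000)
      \<le> (\<Sum>i<74. ln (real (a i) + 1)) + (\<Sum>i<74. ln (y i))"
    using sum_ln_log_ratios_ge by (simp add: y_def)
  also have "\<dots> = (\<Sum>i<74. ln ((real (a i) + 1) * y i))"
    unfolding sum.distrib[symmetric] by (intro sum.cong) (auto simp: ln_mult dest!: y)
  also have "\<dots> \<le> 74 * ln ((weighted_sum a + 8059781 / 10 ^ 5) / 74)"
    using sum_ln_le_ln_mean[of "{..<74::nat}" "\<lambda>i. (real (a i) + 1) * y i"] y sum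
    by (simp add: lessThan_empty_iff)
  \<comment> \<open>The mean of the \<open>y i\<close> is about 1.0892, so this needs
    \<open>1 + weighted_sum a / 74\<close> above 0.0892 / 0.033, about 2.70; 96/35 exceeds
    that.\<close>
  also have "\<dots> < 74 * ln ((1 + weighted_sum a / 74) * (1033 / 1000))"
    using A by (simp add: field_simps)
  also have "\<dots> = 74 * ln (1 + weighted_sum a / 74) + 74 * ln (1033 / 1000)"
    using A by (subst ln_mult) auto
  finally show ?thesis by simp
qed

lemma sum_ln_less:
  assumes a: "\<And>i. i < 74 \<Longrightarrow> 1 \<le> a i"
  shows "(\<Sum>i<74. ln (real (a i) + 1)) < 74 * ln (1 + weighted_sum a / 74)"
    and "74 \<le> weighted_sum a"
proof -
  define A where "A = 1 + weighted_sum a / 74"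
  have "(\<Sum>i<74. 1 * (real_of_int (log_ratios ! i) / 10 ^ 5)) \<le> weighted_sum a"
    unfolding weighted_sum_def using a log_ratios_pos
    by (intro sum_mono mult_right_mono) (auto simp: less_imp_le)
  then have W: "8059781 / 10 ^ 5 \<le> weighted_sum a"
    using sum_log_ratios by (simp flip: sum_divide_distrib)
  then show "74 \<le> weighted_sum a" by simp
  \<comment> \<open>When all exponents are 1, \<open>A\<close> is about 2.089, slightly above the
    first breakpoint.\<close>
  have "25 / 12 \<le> A" using W by (simp add: A_def)
  then consider "25 / 12 \<le> A" "A \<le> 30 / 13" | "30 / 13 \<le> A" "A \<le> 7 / 3" | "7 / 3 \<le> A"
    "A \<le> 33 / 14" | "33 / 14 \<le> A" "A \<le> 63 / 26" | "63 / 26 \<le> A" "A \<le> 96 / 35" | "96 / 35 \<le> A"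
    by linarith
  then show "(\<Sum>i<74. ln (real (a i) + 1)) < 74 * ln (1 + weighted_sum a / 74)"
  proof cases
    case 1
    then show ?thesis
      using ln_breakpoints
      by (intro sum_ln_less_on_interval[OF line_456(1) a line_456(2,3),
          where ?A0.0 = "25 / 12" and ?A1.0 = "30 / 13"]) (auto simp: A_def)
  next
    case 2
    then show ?thesis
      using ln_breakpoints
      by (intro sum_ln_less_on_interval[OF line_431(1) a line_431(2,3),
          where ?A0.0 = "30 / 13" and ?A1.0 = "7 / 3"]) (auto simp: A_def)
  next
    case 3
    then show ?thesis
      using ln_breakpoints
      by (intro sum_ln_less_on_interval[OF line_426(1) a line_426(2,3),
          where ?A0.0 = "7 / 3" and ?A1.0 = "33 / 14"]) (auto simp: A_def)
  next
    case 4
    then show ?thesis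
      using ln_breakpoints
      by (intro sum_ln_less_on_interval[OF line_418(1) a line_418(2,3),
          where ?A0.0 = "33 / 14" and ?A1.0 = "63 / 26"]) (auto simp: A_def)
  next
    case 5
    then show ?thesis
      using ln_breakpoints
      by (intro sum_ln_less_on_interval[OF line_387(1) a line_387(2,3),
          where ?A0.0 = "63 / 26" and ?A1.0 = "96 / 35"]) (auto simp: A_def)
  next
    case 6
    then show ?thesis using a by (intro sum_ln_less_tail) (auto simp: A_def)
  qed
qed

text \<open>The i-th smallest prime factor is at least the i-th prime, so
  \<open>weighted_sum a * ln 74 \<le> ln n\<close>; the bound increases with
  \<open>ln n\<close>.\<close>

lemma divisor_bound_74:
  assumes "n > 0" "card (prime_factors n) = 74"
  shows "74 * ln 74 \<le> ln (real n)"
    and "real (divisor_count n) < (1 + ln (real n) / (74 * ln 74)) ^ 74"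
proof -
  define qs where "qs = sorted_list_of_set (prime_factors n)"
  define a where "a i = multiplicity (qs ! i) n" for i
  have qs: "set qs = prime_factors n" "length qs = 74" "sorted_wrt (<) qs" "distinct qs"
    using assms by (auto simp: qs_def)
  have reindex: "(\<Sum>p\<in>prime_factors n. f p) = (\<Sum>i<74. f (qs ! i))" for f :: "nat \<Rightarrow> real"
    using sum_list_distinct_conv_sum_set[OF qs(4), of f] qs(1,2)
    by (simp add: sum_list_sum_nth atLeast0LessThan)
  have primes: "prime q" if "q \<in> set qs" for q using qs(1) that by auto
  have prime: "prime (qs ! i)" "qs ! i dvd n" if "i < 74" for i
    using qs(1,2) that nth_mem[of i qs] by auto
  have a: "1 \<le> a i" if "i < 74" for i
    using prime[OF that] assms(1) by (simp add: a_def Suc_leI prime_multiplicity_gt_zero_iff)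
  have "ln (real n) = ln (\<Prod>p\<in>prime_factors n. real p ^ multiplicity p n)"
    by (subst (1) prime_factorization_nat[OF assms(1)]) simp
  also have "\<dots> = (\<Sum>p\<in>prime_factors n. real (multiplicity p n) * ln (real p))"
    by (subst ln_prod) (auto simp: ln_realpow dest!: in_prime_factors_imp_prime prime_gt_0_nat)
  also have "\<dots> = (\<Sum>i<74. real (a i) * ln (real (qs ! i)))"
    by (simp add: reindex a_def)
  finally have ln_n: "ln (real n) = (\<Sum>i<74. real (a i) * ln (real (qs ! i)))" .
  have W: "weighted_sum a * ln 74 \<le> ln (real n)"
    unfolding ln_n weighted_sum_def sum_distrib_right mult.assoc
  proof (intro sum_mono mult_left_mono)
    fix i :: nat assume "i \<in> {..<74}"
    then have i: "i < 74" by simp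
    have "real_of_int (log_ratios ! i) / 10 ^ 5 * ln 74 \<le> ln (real (first_primes ! i))"
      by (rule log_ratios_le[OF i])
    also have "\<dots> \<le> ln (real (qs ! i))"
    proof -
      have "list_all (\<lambda>p. 0 < p) first_primes" by (simp add: first_primes_def)
      then have "0 < first_primes ! i"
        using i by (simp add: list_all_length length_first_primes)
      then show ?thesis
        using nth_first_primes_le[OF qs(3) primes, of i] qs(2) i by simp
    qed
    finally show "real_of_int (log_ratios ! i) / 10 ^ 5 * ln 74 \<le> ln (real (qs ! i))" .
  qed auto
  have "74 * ln 74 \<le> weighted_sum a * ln 74"
    using sum_ln_less(2)[OF a] by (intro mult_right_mono) auto
  with W show "74 * ln 74 \<le> ln (real n)" by linarith
  have pos: "1 + ln (real n) / (74 * ln 74) > 0"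
    using assms(1) by (auto intro!: add_pos_nonneg)
  have "divisor_count n > 0" using assms(1) by (auto simp: divisor_count_def card_gt_0_iff)
  then have "ln (real (divisor_count n)) \<le> ln (real (\<Prod>p\<in>prime_factors n. multiplicity p n + 1))"
    using divisor_count_le_prod[OF assms(1)] by (subst ln_le_cancel_iff) (auto simp del: of_nat_prod)
  also have "\<dots> = (\<Sum>p\<in>prime_factors n. ln (real (multiplicity p n) + 1))"
    unfolding of_nat_prod by (subst ln_prod) (auto simp: add.commute)
  also have "\<dots> = (\<Sum>i<74. ln (real (a i) + 1))"
    by (simp add: reindex a_def)
  also have "\<dots> < 74 * ln (1 + weighted_sum a / 74)" by (rule sum_ln_less(1)[OF a])
  also have "\<dots> \<le> 74 * ln (1 + ln (real n) / (74 * ln 74))"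
  proof -
    have "weighted_sum a \<ge> 74" by (rule sum_ln_less(2)[OF a])
    moreover have "weighted_sum a / 74 \<le> ln (real n) / (74 * ln 74)"
      using W by (simp add: field_simps)
    ultimately show ?thesis by simp
  qed
  also have "\<dots> = ln ((1 + ln (real n) / (74 * ln 74)) ^ 74)"
    using pos by (subst ln_realpow) auto
  finally show "real (divisor_count n) < (1 + ln (real n) / (74 * ln 74)) ^ 74"
    using \<open>divisor_count n > 0\<close> pos by (subst (asm) ln_less_cancel_iff) auto
qed

section \<open>Induction on the number of prime factors\<close>

text \<open>The first conjunct supplies \<open>A \<ge> 2\<close> in
  \<open>divisor_bound_step\<close>; strictness is inherited from 74 prime factors.\<close>

lemma divisor_bound_induct:
  assumes "k \<ge> 74" "n > 0" "card (prime_factors n) = k"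
  shows "real k * ln (real k) \<le> ln (real n) \<and>
    real (divisor_count n) < (1 + ln (real n) / (real k * ln (real k))) ^ k"
  using assms
proof (induction k arbitrary: n rule: nat_induct_at_least)
  case base
  then show ?case using divisor_bound_74 by simp
next
  case (Suc k)
  define qs where "qs = sorted_list_of_set (prime_factors n)"
  define p where "p = qs ! k"
  have qs: "set qs = prime_factors n" "length qs = Suc k" "sorted_wrt (<) qs"
    using Suc.prems by (auto simp: qs_def)
  have p: "p \<in> prime_factors n" using qs(1,2) nth_mem[of k qs] by (simp add: p_def)
  have "64 * (k + 1) \<le> 15 * p"
    unfolding p_def using qs Suc.hyps by (intro sorted_primes_ge) auto
  then have "real (64 * (k + 1)) \<le> real (15 * p)" by (simp only: of_nat_le_iff)
  then have "64 / 15 * (real k + 1) \<le> real p" by simp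
  then have "ln (64 / 15 * (real k + 1)) \<le> ln (real p)"
    using Suc.hyps by (subst ln_le_cancel_iff) auto
  moreover have "ln (64 / 15 * (real k + 1)) = ln (64 / 15) + ln (real k + 1)"
    by (subst ln_mult) auto
  \<comment> \<open>Source of the constant 29/20: \<open>ln (64 / 15)\<close> is about 1.4508, and
    64/15 involves only the primes 2, 3 and 5.\<close>
  moreover have "29 / 20 \<le> ln (64 / 15 :: real)"
    using ln_realpow[of 2 6] ln_mult[of 3 5] ln_2 ln_3 ln_5
    by (simp add: ln_div ln_lo_def ln_hi_def)
  ultimately have lnp: "ln (real k + 1) + 29 / 20 \<le> ln (real p)" by linarith
  obtain a m where am: "n = p ^ a * m" "a \<ge> 1" "m > 0" "prime_factors m = prime_factors n - {p}"
    using split_off_prime_factor[OF Suc.prems(1) p] .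
  have "card (prime_factors m) = k" using am(4) p Suc.prems by simp
  then have IH: "real k * ln (real k) \<le> ln (real m)"
    "real (divisor_count m) < (1 + ln (real m) / (real k * ln (real k))) ^ k"
    using Suc.IH[OF am(3)] by auto
  have "prime p" using p by auto
  then have ln_n: "ln (real n) = ln (real m) + real a * ln (real p)"
    using am(1,3) by (simp add: ln_mult ln_realpow prime_gt_0_nat)
  have "ln (75::real) \<ge> 43 / 10"
    using ln_mult[of 3 25] ln_realpow[of 5 2] ln_3 ln_5 by (simp add: ln_lo_def)
  also have "ln 75 \<le> ln (real k + 1)" using Suc.hyps by simp
  finally have l: "43 / 10 \<le> ln (real k + 1)" .
  have "1 * ln (real p) \<le> real a * ln (real p)"
    using am(2) lnp l by (intro mult_right_mono) auto
  moreover have "real k * ln (real k + 1) \<le> real k * ln (real k) + 1"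
    using ln_Suc_diff_le[of k] Suc.hyps by (simp add: algebra_simps)
  moreover have "real (Suc k) * ln (real (Suc k)) = real k * ln (real k + 1) + ln (real k + 1)"
    by (simp add: algebra_simps)
  \<comment> \<open>Passing to \<open>Suc k\<close> costs at most \<open>1 + ln (k + 1)\<close>,
    while the new prime contributes at least \<open>ln (k + 1) + 29/20\<close>.\<close>
  ultimately have 1: "real (Suc k) * ln (real (Suc k)) \<le> ln (real n)"
    using IH(1) lnp ln_n by linarith
  have "real (divisor_count n) \<le> (real a + 1) * real (divisor_count m)"
    using divisor_count_primepow_mult_le[OF \<open>prime p\<close> am(3), of a] am(1)
    by (metis of_nat_1 of_nat_add of_nat_le_iff of_nat_mult)
  also have "\<dots> < (real a + 1) * (1 + ln (real m) / (real k * ln (real k))) ^ k"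
    using IH(2) by (intro mult_strict_left_mono) auto
  also have "\<dots> \<le> (1 + (ln (real m) + real a * ln (real p)) / (real (k + 1) * ln (real (k + 1)))) ^ (k + 1)"
    using Suc.hyps l IH(1) am(2) lnp by (intro divisor_bound_step) auto
  finally have 2: "real (divisor_count n) < (1 + ln (real n) / (real (Suc k) * ln (real (Suc k)))) ^ Suc k"
    by (simp add: ln_n)
  show ?case using 1 2 by simp
qed

theorem theorem4:
  fixes n k :: nat
  assumes "n > 0" and "k = primes_omega n" and "k \<ge> 74"
  shows "real (divisor_count n) < (1 + ln (real n) / (real k * ln (real k))) ^ k"
  using divisor_bound_induct[of k n] assms unfolding primes_omega_def by blast

end
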